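(* Let $p\in\mathbb{R}[x]$ be a polynomial. Then the sequence $f(n)=\lfloor p(n)\rfloor$, $n\ge 0$, is regular if and only if all the coefficients of $p$, except possibly for the constant term, are rational.
   Context: $\mathbb{N}_0=\{0,1,2,\dots\}$. Let $k\ge 2$ be an integer. The $k$-kernel of a sequence $(a_n)_{n\ge0}$ is the set of its subsequences $\{(a_{k^l n+r})_{n\ge 0} : l\ge 0,\ 0\le r<k^l\}$. A sequence $(a_n)_{n\ge 0}$ of integers is $k$-regular if its $k$-kernel spans a finitely generated abelian subgroup of $\mathbb{Z}^{\mathbb{N}_0}$. A sequence is regular if it is $k$-regular for some integer $k\ge 2$. *)

theory Defs
  imports
    Complex_Main
    "HOL-Computational_Algebra.Polynomial"
    "HOL-Algebra.Product_Groups"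
begin

definition kernel_of_seq :: "nat \<Rightarrow> (nat \<Rightarrow> 'a) \<Rightarrow> (nat \<Rightarrow> 'a) set" where
  "kernel_of_seq k a = {(\<lambda>n. a (k ^ l * n + r)) | l r. r < k ^ l}"

abbreviation int_seq_group :: "(nat \<Rightarrow> int) monoid" where
  "int_seq_group \<equiv> product_group UNIV (\<lambda>_. integer_group)"

lemma carrier_int_seq_group: "carrier int_seq_group = UNIV"
  by (simp add: integer_group_def)

lemma mult_int_seq_group: "f \<otimes>\<^bsub>int_seq_group\<^esub> g = (\<lambda>n. f n + g n)"
  by (simp add: product_group_def integer_group_def restrict_def)

lemma group_int_seq_group: "group int_seq_group"
  by simp

definition fin_gen_subgroup :: "('a, 'b) monoid_scheme \<Rightarrow> 'a set \<Rightarrow> bool" where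
  "fin_gen_subgroup G H \<longleftrightarrow>
     subgroup H G \<and> (\<exists>S. finite S \<and> S \<subseteq> carrier G \<and> H = generate G S)"

(* Meaningful for k \<ge> 2 only; the side condition is imposed in regular_seq. *)
definition k_regular :: "nat \<Rightarrow> (nat \<Rightarrow> int) \<Rightarrow> bool" where
  "k_regular k a \<longleftrightarrow>
     fin_gen_subgroup int_seq_group (generate int_seq_group (kernel_of_seq k a))"

definition regular_seq :: "(nat \<Rightarrow> int) \<Rightarrow> bool" where
  "regular_seq a \<longleftrightarrow> (\<exists>k\<ge>2. k_regular k a)"

end

(*
  If the non-constant coefficients are rational with common denominator D, then
  D * floor (p n) = P n - (P n mod D) for an integer polynomial P. Up to the factor D, the kernel
  thus lies in the group generated by finitely many monomials and finitely many indicators of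
  residue classes mod D, and subgroups of finitely generated abelian groups are finitely generated.

  Conversely, reducing a k-regular sequence f modulo m leaves a finite kernel, so there are i < j
  with f (k^i n) = f (k^j n) mod m for all n. For f = floor o p this forces the polynomial
  (p (k^i x) - p (k^j x)) / m to stay within 1 / m of the integers. On multiples of m N, for a suitable
  N, the terms above the highest irrational one of p, of degree e, become integers, so what is left
  is a polynomial of degree e with irrational leading coefficient. Taking e - 1 successive
  differences reduces to a linear polynomial with irrational slope, which cannot stay within 1/8 of
  the integers; hence m = 2^(e + 2) gives a contradiction.
*)

theory Submission
  imports Defs
    "HOL-Library.Function_Algebras"
    "HOL-Number_Theory.Cong"
begin

section \<open>Integer sequences as a module over the integers\<close>

text \<open>Multiplication by integers makes the sequences a module whose submodules are exactly the
  subgroups, so that \<open>span\<close>, \<open>subspace\<close> and facts such as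
  \<open>span_insert\<close> become available.\<close>

definition seq_scale :: "int \<Rightarrow> (nat \<Rightarrow> int) \<Rightarrow> nat \<Rightarrow> int" where
  "seq_scale c f = (\<lambda>n. c * f n)"

interpretation seq: module seq_scale
  by unfold_locales (auto simp: seq_scale_def plus_fun_def algebra_simps)

lemma sum_fun_apply:
  fixes f :: "'i \<Rightarrow> 'a \<Rightarrow> 'b :: comm_monoid_add"
  shows "sum f A x = (\<Sum>i\<in>A. f i x)"
  by (induction A rule: infinite_finite_induct) auto

text \<open>Integer multiples are iterated sums and inverses, so a subgroup is closed under
  \<open>seq_scale\<close>. With this bridge everything below can be done with
  \<open>seq.span\<close>.\<close>

lemma generate_int_seq_group: "generate int_seq_group S = seq.span S"
proof (rule equalityI)
  interpret G: group int_seq_group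
    by (rule group_int_seq_group)
  have sub: "subgroup (generate int_seq_group S) int_seq_group"
    by (rule G.generate_is_subgroup) (simp add: carrier_int_seq_group)
  have inv: "inv\<^bsub>int_seq_group\<^esub> g = - g" for g
    by (rule G.inv_equality)
       (auto simp: mult_int_seq_group carrier_int_seq_group one_product_group fun_eq_iff)
  have mult: "g \<otimes>\<^bsub>int_seq_group\<^esub> h = g + h" for g h
    by (auto simp: fun_eq_iff)
  have one: "\<one>\<^bsub>int_seq_group\<^esub> = 0"
    by (auto simp: fun_eq_iff)
  show "generate int_seq_group S \<subseteq> seq.span S"
  proof
    fix g assume "g \<in> generate int_seq_group S"
    then show "g \<in> seq.span S"
      by induction
        (simp_all only: inv mult one seq.span_zero seq.span_base seq.span_add seq.span_neg)
  qed
  have nat_scale: "seq_scale (int c) g \<in> generate int_seq_group S"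
    if "g \<in> generate int_seq_group S" for c g
  proof (induction c)
    case 0
    then show ?case
      using subgroup.one_closed[OF sub] unfolding one
      by (simp only: of_nat_0 seq.scale_zero_left)
  next
    case (Suc c)
    then show ?case
      using subgroup.m_closed[OF sub that Suc.IH] unfolding mult
      by (simp only: of_nat_Suc seq.scale_left_distrib seq.scale_one)
  qed
  have "seq.subspace (generate int_seq_group S)"
  proof (rule seq.subspaceI)
    show "0 \<in> generate int_seq_group S"
      using subgroup.one_closed[OF sub] unfolding one .
    show "g + h \<in> generate int_seq_group S"
      if "g \<in> generate int_seq_group S" "h \<in> generate int_seq_group S" for g h
      using subgroup.m_closed[OF sub that] unfolding mult .
    show "seq_scale c g \<in> generate int_seq_group S" if g: "g \<in> generate int_seq_group S" for c g
    proof (cases c rule: int_cases2)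
      case (nonneg n)
      then show ?thesis
        using nat_scale[OF g] by simp
    next
      case (nonpos n)
      then show ?thesis
        using subgroup.m_inv_closed[OF sub nat_scale[OF g, of n]] unfolding inv by simp
    qed
  qed
  then show "seq.span S \<subseteq> generate int_seq_group S"
    by (intro seq.span_minimal) (auto intro: generate.incl)
qed

lemma k_regular_iff_span:
  "k_regular k a \<longleftrightarrow> (\<exists>S. finite S \<and> seq.span (kernel_of_seq k a) = seq.span S)"
proof -
  interpret G: group int_seq_group
    by (rule group_int_seq_group)
  have "subgroup (generate int_seq_group (kernel_of_seq k a)) int_seq_group"
    by (rule G.generate_is_subgroup) (simp add: carrier_int_seq_group)
  then show ?thesis
    unfolding k_regular_def fin_gen_subgroup_def carrier_int_seq_group
    by (simp add: generate_int_seq_group)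
qed

section \<open>Submodules of finitely generated modules\<close>

lemma int_subgroup_principal:
  fixes I :: "int set"
  assumes "0 \<in> I" and diff: "\<And>x y. x \<in> I \<Longrightarrow> y \<in> I \<Longrightarrow> x - y \<in> I"
    and mult: "\<And>c x. x \<in> I \<Longrightarrow> c * x \<in> I"
  shows "\<exists>g\<in>I. \<forall>x\<in>I. g dvd x"
proof (cases "I = {0}")
  case True
  then show ?thesis
    by auto
next
  case False
  then obtain x where x: "x \<in> I" "x \<noteq> 0"
    using \<open>0 \<in> I\<close> by auto
  have "\<bar>x\<bar> \<in> I"
    using mult[OF x(1), of "sgn x"] by (simp add: mult.commute mult_sgn_abs abs_sgn)
  with x have ex: "\<exists>n::nat. n > 0 \<and> int n \<in> I"
    by (intro exI[of _ "nat \<bar>x\<bar>"]) auto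
  define n where "n = (LEAST n::nat. n > 0 \<and> int n \<in> I)"
  have n: "n > 0" "int n \<in> I"
    using LeastI_ex[OF ex] unfolding n_def by auto
  have least: "n \<le> j" if "j > 0" "int j \<in> I" for j
    unfolding n_def by (rule Least_le) (use that in auto)
  have "int n dvd y" if y: "y \<in> I" for y
  proof -
    have mem: "y mod int n \<in> I"
      using diff[OF y mult[OF n(2), of "y div int n"]]
      by (simp add: minus_div_mult_eq_mod)
    have "\<not> y mod int n > 0"
    proof
      assume pos: "y mod int n > 0"
      then have "n \<le> nat (y mod int n)"
        using mem by (intro least) auto
      then show False
        using pos_mod_bound[of "int n" y] n(1) pos by linarith
    qed
    then have "y mod int n = 0"
      using pos_mod_sign[of "int n" y] n(1) by linarith
    then show ?thesis
      by auto
  qed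
  with n show ?thesis
    by blast
qed

text \<open>Induction on \<open>B\<close>, as for subgroups of Z^n: one generator takes care of the
  multiples of \<open>b\<close>, the others come from the induction hypothesis. The factor
  \<open>D\<close> is carried along because later only \<open>D\<close> times the kernel is placed
  in a finitely generated module; it does no harm, since integer sequences are torsion-free.\<close>

lemma subspace_finitely_generated:
  assumes "finite B" and "D \<noteq> 0" and "seq.subspace H"
    and "\<And>h. h \<in> H \<Longrightarrow> seq_scale D h \<in> seq.span B"
  shows "\<exists>T. finite T \<and> H = seq.span T"
  using assms(1,3,4)
proof (induction B arbitrary: H rule: finite_induct)
  case empty
  have "h = 0" if "h \<in> H" for h
  proof -
    have "seq_scale D h = 0"
      using empty(2)[OF that] by simp
    then show ?thesis
      using \<open>D \<noteq> 0\<close> by (auto simp: seq_scale_def fun_eq_iff)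
  qed
  then have "H = seq.span {}"
    using seq.subspace_0[OF empty(1)] by auto
  then show ?case
    by blast
next
  case (insert b B)
  note H = insert.prems(1)
  \<comment> \<open>The coefficients of \<open>b\<close> that occur in \<open>D\<close> times the
    elements of \<open>H\<close> form an ideal, hence are the multiples of a single
    \<open>c0\<close>, attained at some \<open>h0\<close>.\<close>
  define I where "I = {c. \<exists>h\<in>H. seq_scale D h - seq_scale c b \<in> seq.span B}"
  have I_zero: "0 \<in> I"
    using seq.subspace_0[OF H] by (auto simp: I_def seq.span_zero intro!: bexI[of _ 0])
  have I_diff: "x - y \<in> I" if "x \<in> I" "y \<in> I" for x y
  proof -
    from that obtain g h where "g \<in> H" "seq_scale D g - seq_scale x b \<in> seq.span B"
      "h \<in> H" "seq_scale D h - seq_scale y b \<in> seq.span B"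
      unfolding I_def by blast
    moreover from this have "seq_scale D (g - h) - seq_scale (x - y) b \<in> seq.span B"
      using seq.span_diff[of "seq_scale D g - seq_scale x b" B "seq_scale D h - seq_scale y b"]
      by (simp add: seq.scale_right_diff_distrib seq.scale_left_diff_distrib algebra_simps)
    ultimately show ?thesis
      using seq.subspace_diff[OF H] unfolding I_def by blast
  qed
  have I_mult: "c * x \<in> I" if "x \<in> I" for c x
  proof -
    from that obtain g where g: "g \<in> H" "seq_scale D g - seq_scale x b \<in> seq.span B"
      unfolding I_def by blast
    have "seq_scale D (seq_scale c g) - seq_scale (c * x) b \<in> seq.span B"
      using seq.span_scale[OF g(2), of c]
      by (simp add: seq.scale_right_diff_distrib mult.commute)
    then show ?thesis
      using seq.subspace_scale[OF H g(1), of c] by (auto simp only: I_def mem_Collect_eq intro: bexI)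
  qed
  obtain c0 where "c0 \<in> I" and c0_dvd: "\<And>x. x \<in> I \<Longrightarrow> c0 dvd x"
    using int_subgroup_principal[OF I_zero I_diff I_mult] by blast
  then obtain h0 where h0: "h0 \<in> H" "seq_scale D h0 - seq_scale c0 b \<in> seq.span B"
    unfolding I_def by blast
  define H' where "H' = {h \<in> H. seq_scale D h \<in> seq.span B}"
  have sub': "seq.subspace H'"
  proof (rule seq.subspaceI)
    show "0 \<in> H'"
      using seq.subspace_0[OF H] seq.span_zero unfolding H'_def mem_Collect_eq seq.scale_zero_right
      by blast
    show "g + h \<in> H'" if "g \<in> H'" "h \<in> H'" for g h
      using that seq.subspace_add[OF H] seq.span_add
      unfolding H'_def mem_Collect_eq seq.scale_right_distrib by blast
    show "seq_scale c g \<in> H'" if "g \<in> H'" for c g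
      using that seq.subspace_scale[OF H, of g c] seq.span_scale[of "seq_scale D g" B c]
      unfolding H'_def mem_Collect_eq by (simp only: seq.scale_scale mult.commute)
  qed
  have "seq_scale D h \<in> seq.span B" if "h \<in> H'" for h
    using that unfolding H'_def by blast
  from insert.IH[OF sub' this] obtain T where T: "finite T" "H' = seq.span T"
    by blast
  have "H \<subseteq> seq.span (insert h0 T)"
  proof
    fix h assume h: "h \<in> H"
    then obtain c where c: "seq_scale D h - seq_scale c b \<in> seq.span B"
      using insert.prems(2) unfolding seq.span_insert by blast
    then have "c0 dvd c"
      using c0_dvd h unfolding I_def by blast
    then obtain q where q: "c = q * c0"
      by (metis dvd_def mult.commute)
    \<comment> \<open>Subtracting \<open>q\<close> times \<open>h0\<close> removes the multiple of
      \<open>b\<close>, so what remains lies in \<open>H'\<close>.\<close>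
    have "seq_scale D (h - seq_scale q h0) \<in> seq.span B"
      using seq.span_diff[OF c seq.span_scale[OF h0(2), of q]]
      by (simp add: q seq.scale_right_diff_distrib mult.commute)
    then have "h - seq_scale q h0 \<in> seq.span T"
      using seq.subspace_diff[OF H h seq.subspace_scale[OF H h0(1)]] T(2) unfolding H'_def
      by blast
    then show "h \<in> seq.span (insert h0 T)"
      unfolding seq.span_insert by blast
  qed
  moreover have "seq.span (insert h0 T) \<subseteq> H"
  proof (rule seq.span_minimal)
    show "insert h0 T \<subseteq> H"
      using h0(1) seq.span_superset[of T] T(2) unfolding H'_def by blast
  qed (rule H)
  ultimately show ?case
    using T(1) by blast
qed

section \<open>Reduction modulo m\<close>

lemma finite_span_mod:
  fixes m :: int
  assumes "finite S" and "m > 0"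
  shows "finite ((\<lambda>g n. g n mod m) ` seq.span S)"
  using assms(1)
proof induction
  case empty
  then show ?case by simp
next
  case (insert a S)
  \<comment> \<open>Only the residue of the coefficient of \<open>a\<close> matters, so a new
    generator multiplies the number of reduced sequences by at most \<open>m\<close>.\<close>
  have "(\<lambda>g n. g n mod m) ` seq.span (insert a S) \<subseteq>
    (\<lambda>(c, y) n. (c * a n + y n) mod m) ` ({0..<m} \<times> (\<lambda>g n. g n mod m) ` seq.span S)"
  proof (rule image_subsetI)
    fix g assume "g \<in> seq.span (insert a S)"
    then obtain c where c: "g - seq_scale c a \<in> seq.span S"
      by (auto simp: seq.span_insert)
    have "(c mod m * a n + (g n - c * a n) mod m) mod m = (c * a n + (g n - c * a n)) mod m" for n
      by (intro mod_add_cong mod_mult_cong) simp_all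
    then have "(\<lambda>n. g n mod m) =
      (\<lambda>(c, y) n. (c * a n + y n) mod m) (c mod m, \<lambda>n. (g - seq_scale c a) n mod m)"
      by (simp add: fun_eq_iff seq_scale_def)
    then show "(\<lambda>n. g n mod m) \<in> (\<lambda>(c, y) n. (c * a n + y n) mod m) `
      ({0..<m} \<times> (\<lambda>g n. g n mod m) ` seq.span S)"
      by (rule image_eqI) (use c \<open>m > 0\<close> in \<open>simp del: minus_apply\<close>)
  qed
  then show ?case
    by (rule finite_subset) (use insert.IH in auto)
qed

text \<open>Pigeonhole: the dilations by \<open>k ^ i\<close> are the kernel members with
  \<open>r = 0\<close>, and the span containing them has only finitely many reductions modulo
  \<open>m\<close>.\<close>

lemma k_regular_dilations_cong:
  fixes m :: int
  assumes "k_regular k f" and "k \<ge> 2" and "m > 0"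
  shows "\<exists>i j. i \<noteq> j \<and> (\<forall>n. [f (k ^ i * n) = f (k ^ j * n)] (mod m))"
proof -
  obtain S where S: "finite S" "seq.span (kernel_of_seq k f) = seq.span S"
    using assms(1) by (auto simp: k_regular_iff_span)
  have "(\<lambda>n. f (k ^ i * n)) \<in> kernel_of_seq k f" for i
  proof -
    have "(\<lambda>n. f (k ^ i * n)) = (\<lambda>n. f (k ^ i * n + 0)) \<and> 0 < k ^ i"
      using \<open>k \<ge> 2\<close> by simp
    then show ?thesis
      unfolding kernel_of_seq_def by blast
  qed
  then have "range (\<lambda>i n. f (k ^ i * n) mod m) \<subseteq> (\<lambda>g n. g n mod m) ` seq.span S"
    unfolding S(2)[symmetric] by (auto intro!: image_eqI seq.span_base)
  then have "finite (range (\<lambda>i n. f (k ^ i * n) mod m))"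
    using finite_span_mod[OF S(1) \<open>m > 0\<close>] finite_subset by blast
  then have "\<not> inj (\<lambda>i n. f (k ^ i * n) mod m)"
    using finite_imageD infinite_UNIV_nat by blast
  then show ?thesis
    unfolding inj_def cong_def by (metis (no_types))
qed

section \<open>Polynomials that stay close to the integers\<close>

text \<open>If all values stayed within 1/8 of the integers, subtracting the value at 0 and an
  integer from the slope would leave a nonzero \<open>h\<close> with |h| at most 1/4, all of whose
  multiples are within 1/4 of the integers. Steps this short cannot leap over the range from 1/4 to
  1/2, where the distance to the integers exceeds 1/4.\<close>

lemma linear_far_from_Ints:
  fixes a b :: real
  assumes "a \<notin> \<rat>"
  shows "\<exists>n::nat. \<forall>z::int. \<bar>a * n + b - z\<bar> > 1/8"
proof (rule ccontr)
  assume "\<not> ?thesis"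
  then have "\<forall>n::nat. \<exists>z::int. \<bar>a * n + b - z\<bar> \<le> 1/8"
    by (simp add: not_less)
  then obtain z :: "nat \<Rightarrow> int" where z: "\<And>n::nat. \<bar>a * n + b - real_of_int (z n)\<bar> \<le> 1/8"
    using choice[of "\<lambda>n z. \<bar>a * real n + b - real_of_int z\<bar> \<le> 1/8"] by blast
  define h where "h = a - of_int (z 1 - z 0)"
  have "h \<noteq> 0"
    using assms unfolding h_def by (metis Rats_of_int eq_iff_diff_eq_0)
  have h: "\<bar>h\<bar> \<le> 1/4"
  proof -
    have "\<bar>b - z 0\<bar> \<le> 1/8" "\<bar>a + b - z 1\<bar> \<le> 1/8"
      using z[of 0] z[of 1] by simp_all
    then show ?thesis
      unfolding h_def of_int_diff by linarith
  qed
  have near: "\<bar>h * n - real_of_int (z n - z 0 - int n * (z 1 - z 0))\<bar> \<le> 1/4" for n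
  proof -
    have "h * n - real_of_int (z n - z 0 - int n * (z 1 - z 0)) = (a * n + b - z n) - (b - z 0)"
      by (simp add: h_def algebra_simps)
    moreover have "\<bar>b - z 0\<bar> \<le> 1/8"
      using z[of 0] by simp
    ultimately show ?thesis
      using z[of n] by linarith
  qed
  obtain N :: nat where N: "1/4 < \<bar>h\<bar> * N"
    using reals_Archimedean3[of "\<bar>h\<bar>"] \<open>h \<noteq> 0\<close> by (metis mult.commute zero_less_abs_iff)
  \<comment> \<open>The first multiple of |h| beyond 1/4 exceeds its predecessor by at most 1/4, so
    it is at most 1/2.\<close>
  define j where "j = (LEAST n::nat. 1/4 < \<bar>h\<bar> * n)"
  have j: "1/4 < \<bar>h\<bar> * j"
    unfolding j_def by (rule LeastI[of _ N]) (rule N)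
  then have "j \<noteq> 0"
    by (intro notI) simp
  then have "\<not> 1/4 < \<bar>h\<bar> * (j - 1 :: nat)"
    unfolding j_def using not_less_Least[of "j - 1" "\<lambda>n::nat. 1/4 < \<bar>h\<bar> * n"]
    by (simp add: j_def)
  then have "\<bar>h\<bar> * j \<le> 1/2"
    using h \<open>j \<noteq> 0\<close> by (simp add: of_nat_diff right_diff_distrib)
  with j have "1/4 < \<bar>h * j\<bar>" "\<bar>h * j\<bar> \<le> 1/2"
    by (simp_all add: abs_mult)
  with near[of j] obtain w :: int where "\<bar>h * j - w\<bar> \<le> 1/4" "1/4 < \<bar>h * j\<bar>" "\<bar>h * j\<bar> \<le> 1/2"
    by blast
  moreover from this have "w \<noteq> 0"
    by auto
  then have "\<bar>real_of_int w\<bar> \<ge> 1"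
    by linarith
  ultimately show False
    by linarith
qed

lemma poly_sum_le_degree:
  fixes q :: "'a :: comm_semiring_1 poly"
  assumes "degree q \<le> d"
  shows "poly q x = (\<Sum>i\<le>d. coeff q i * x ^ i)"
proof -
  have "poly q x = poly (\<Sum>i\<le>d. monom (coeff q i) i) x"
    by (simp add: poly_as_sum_of_monoms' assms)
  then show ?thesis
    by (simp add: poly_sum poly_monom)
qed

text \<open>The forward difference acts on the top coefficient like the derivative.\<close>

lemma poly_shift_diff:
  fixes q :: "real poly"
  assumes "degree q \<le> Suc d"
  shows "degree (pcompose q [:1, 1:] - q) \<le> d \<and>
    coeff (pcompose q [:1, 1:] - q) d = of_nat (Suc d) * coeff q (Suc d)"
  using assms
proof (induction q arbitrary: d)
  case 0
  then show ?case by simp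
next
  case (pCons a q)
  define s where "s = pcompose q [:1, 1:] - q"
  \<comment> \<open>Product rule for the difference of x * q: (x + 1) * (q + s) - x * q = x * s + s
    + q.\<close>
  have eq: "pcompose (pCons a q) [:1, 1:] - pCons a q = pCons 0 s + s + q"
    by (simp add: s_def pcompose_pCons algebra_simps)
  have dq: "degree q \<le> d"
    using pCons.prems by (cases "q = 0") auto
  show ?case
  proof (cases d)
    case 0
    then obtain c where "q = [:c:]"
      using dq degree_eq_zeroE by blast
    then show ?thesis
      using 0 by (simp add: pcompose_pCons)
  next
    case (Suc d')
    have "degree s \<le> d'" "coeff s d' = of_nat (Suc d') * coeff q (Suc d')"
      using pCons.IH[of d'] dq unfolding s_def Suc by auto
    moreover from this have "coeff s d = 0"
      using Suc by (simp add: coeff_eq_0)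
    ultimately show ?thesis
      using dq unfolding eq Suc
      by (auto intro!: degree_add_le simp: degree_pCons_eq_if algebra_simps)
  qed
qed

text \<open>A forward difference lowers the degree bound by one, keeps the top coefficient
  irrational and at most doubles the error of an integer approximation. Hence each degree costs a
  factor 2, starting from 1/8 = 1 / 2 ^ 3 in the linear case.\<close>

lemma poly_far_from_Ints:
  fixes q :: "real poly"
  assumes "degree q \<le> Suc d" and "coeff q (Suc d) \<notin> \<rat>"
  shows "\<exists>n::nat. \<forall>z::int. \<bar>poly q n - z\<bar> > 1 / 2 ^ (d + 3)"
  using assms
proof (induction d arbitrary: q)
  case 0
  have "poly q x = coeff q (Suc 0) * x + coeff q 0" for x
    using 0 poly_sum_le_degree[of q 1 x] by simp
  then show ?case
    using linear_far_from_Ints[OF 0(2)] by simp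
next
  case (Suc d)
  define s where "s = pcompose q [:1, 1:] - q"
  have s: "degree s \<le> Suc d" "coeff s (Suc d) = of_nat (Suc (Suc d)) * coeff q (Suc (Suc d))"
    using poly_shift_diff[OF Suc.prems(1)] by (simp_all add: s_def)
  have "coeff s (Suc d) \<notin> \<rat>"
  proof
    assume "coeff s (Suc d) \<in> \<rat>"
    then have "coeff s (Suc d) / of_nat (Suc (Suc d)) \<in> \<rat>"
      by (intro Rats_divide) auto
    then show False
      using Suc.prems(2) by (simp add: s(2) del: of_nat_Suc)
  qed
  from Suc.IH[OF s(1) this] obtain n :: nat where
    n: "\<And>z::int. \<bar>poly s n - z\<bar> > 1 / 2 ^ (d + 3)"
    by blast
  show ?case
  proof (rule ccontr)
    assume "\<not> ?thesis"
    then have "\<forall>n::nat. \<exists>z::int. \<bar>poly q n - z\<bar> \<le> 1 / 2 ^ (Suc d + 3)"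
      by (simp add: not_less)
    then obtain z :: "nat \<Rightarrow> int" where z: "\<And>n::nat. \<bar>poly q n - real_of_int (z n)\<bar> \<le> 1 / 2 ^ (Suc d + 3)"
      using choice[of "\<lambda>n z. \<bar>poly q (real n) - real_of_int z\<bar> \<le> 1 / 2 ^ (Suc d + 3)"] by blast
    have "poly s n = poly q (Suc n) - poly q n"
      by (simp add: s_def poly_pcompose add.commute)
    then have "\<bar>poly s n - of_int (z (Suc n) - z n)\<bar> \<le> 1 / 2 ^ (Suc d + 3) + 1 / 2 ^ (Suc d + 3)"
      using z[of n] z[of "Suc n"] by simp
    with n[of "z (Suc n) - z n"] show False
      by (simp add: power_add)
  qed
qed

section \<open>Regularity of floors of polynomials\<close>

lemma common_denominator:
  fixes a :: "nat \<Rightarrow> real"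
  assumes "finite A" and "\<And>i. i \<in> A \<Longrightarrow> a i \<in> \<rat>"
  obtains D :: nat where "D > 0" "\<And>i. i \<in> A \<Longrightarrow> of_nat D * a i \<in> \<int>"
proof -
  have "\<exists>D::nat. D > 0 \<and> of_nat D * a i \<in> \<int>" if i: "i \<in> A" for i
  proof -
    obtain m n :: int where "n > 0" "a i = of_int m / of_int n"
      using Rats_cases'[OF assms(2)[OF i]] by metis
    then have "real (nat n) * a i = of_int m" "nat n > 0"
      by simp_all
    then show ?thesis
      by (metis Ints_of_int)
  qed
  then obtain d :: "nat \<Rightarrow> nat" where d: "\<And>i. i \<in> A \<Longrightarrow> d i > 0 \<and> of_nat (d i) * a i \<in> \<int>"
    by metis
  have "of_nat (\<Prod>i\<in>A. d i) * a i \<in> \<int>" if "i \<in> A" for i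
  proof -
    have "of_nat (\<Prod>i\<in>A. d i) * a i = of_nat (\<Prod>j\<in>A - {i}. d j) * (of_nat (d i) * a i)"
      using \<open>finite A\<close> that by (simp add: prod.remove mult_ac)
    moreover have "\<dots> \<in> \<int>"
      by (rule Ints_mult[OF Ints_of_nat]) (simp add: d that)
    ultimately show ?thesis
      by (simp only:)
  qed
  moreover have "(\<Prod>i\<in>A. d i) > 0"
    using d by (simp add: prod_pos)
  ultimately show ?thesis
    using that by blast
qed

lemma cong_poly:
  fixes P :: "int poly"
  assumes "[x = y] (mod m)"
  shows "[poly P x = poly P y] (mod m)"
  by (induction P) (auto intro!: cong_add cong_mult assms)

section \<open>Sufficiency: rational non-constant coefficients\<close>

lemma regular_floor_poly:
  fixes p :: "real poly"
  assumes "\<And>i. i \<ge> 1 \<Longrightarrow> coeff p i \<in> \<rat>"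
  shows "regular_seq (\<lambda>n. \<lfloor>poly p (real n)\<rfloor>)"
proof -
  obtain D :: nat where "D > 0" and D: "\<And>i. i \<in> {1..degree p} \<Longrightarrow> of_nat D * coeff p i \<in> \<int>"
    using common_denominator[of "{1..degree p}" "coeff p"] assms by auto
  define d where "d = degree p"
  \<comment> \<open>Rounding down affects at most the constant coefficient, the others being
    integers already. So \<open>poly P (int n)\<close> is the floor of D * p(n), and the floor of
    p(n) is its integer quotient by \<open>D\<close>.\<close>
  define P where "P = (\<Sum>i\<le>d. monom \<lfloor>real D * coeff p i\<rfloor> i)"
  have poly_P: "poly P x = (\<Sum>i\<le>d. \<lfloor>real D * coeff p i\<rfloor> * x ^ i)" for x
    by (simp add: P_def poly_sum poly_monom)
  have floor_eq: "\<lfloor>poly p (real n)\<rfloor> = poly P (int n) div int D" for n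
  proof -
    have "real D * poly p (real n) = (\<Sum>i\<le>d. real D * coeff p i * real n ^ i)"
      by (simp add: poly_altdef d_def sum_distrib_left mult_ac)
    also have "\<dots> = real D * coeff p 0 + (\<Sum>i\<in>{1..d}. real D * coeff p i * real n ^ i)"
      by (simp add: atMost_atLeast0 sum.atLeast_Suc_atMost)
    also have "(\<Sum>i\<in>{1..d}. real D * coeff p i * real n ^ i) =
        (\<Sum>i\<in>{1..d}. of_int (\<lfloor>real D * coeff p i\<rfloor> * int n ^ i))"
      using D by (intro sum.cong) (auto simp: d_def Ints_def)
    finally have "\<lfloor>real D * poly p (real n)\<rfloor> =
        \<lfloor>real D * coeff p 0\<rfloor> + (\<Sum>i\<in>{1..d}. \<lfloor>real D * coeff p i\<rfloor> * int n ^ i)"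
      by (simp only: of_int_sum[symmetric] floor_add_int)
    also have "\<dots> = poly P (int n)"
      by (simp add: poly_P atMost_atLeast0 sum.atLeast_Suc_atMost)
    finally show ?thesis
      using floor_divide_real_eq_div[of "int D" "real D * poly p (real n)"] \<open>D > 0\<close> by simp
  qed
  have deg_P: "degree P \<le> d"
    unfolding P_def by (intro degree_sum_le) (auto intro: order_trans[OF degree_monom_le])
  define f where "f = (\<lambda>n. \<lfloor>poly p (real n)\<rfloor>)"
  define mon :: "nat \<Rightarrow> nat \<Rightarrow> int" where "mon = (\<lambda>i n. int n ^ i)"
  define ind :: "nat \<Rightarrow> nat \<Rightarrow> int" where "ind = (\<lambda>j n. if n mod D = j then 1 else 0)"
  define B where "B = mon ` {..d} \<union> ind ` {..<D}"
  \<comment> \<open>The base 2 is an arbitrary choice: the argument sees a kernel element only as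
    \<open>f\<close> along an arithmetic progression \<open>K * n + r\<close>. Composing
    \<open>P\<close> with that progression does not raise the degree, so the monomials in
    \<open>B\<close> suffice.\<close>
  have kernel: "seq_scale D g \<in> seq.span B" if g: "g \<in> kernel_of_seq 2 f" for g
  proof -
    obtain K r where g_eq: "g = (\<lambda>n. f (K * n + r))"
      using g by (auto simp: kernel_of_seq_def)
    define R where "R = pcompose P [:int r, int K:]"
    have poly_R: "poly R (int n) = poly P (int (K * n + r))" for n
      by (simp add: R_def poly_pcompose algebra_simps)
    have "degree R \<le> d"
      unfolding R_def using degree_pcompose_le[of P "[:int r, int K:]"] deg_P
      by (auto simp: degree_pCons_eq_if split: if_splits)
    then have R_sum: "poly R x = (\<Sum>i\<le>d. coeff R i * x ^ i)" for x
      by (rule poly_sum_le_degree)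
    \<comment> \<open>An integer polynomial is periodic modulo \<open>D\<close>, so its remainders
      are a combination of the indicators \<open>ind j\<close>.\<close>
    have mod_R: "poly R (int n) mod D = (\<Sum>j<D. (poly R (int j) mod D) * ind j n)" for n
    proof -
      have "[int n = int (n mod D)] (mod D)"
        by (simp add: cong_def zmod_int)
      from cong_poly[OF this] have "poly R (int n) mod D = poly R (int (n mod D)) mod D"
        by (simp only: cong_def)
      then show ?thesis
        using \<open>D > 0\<close> by (simp add: ind_def if_distrib sum.delta cong: if_cong)
    qed
    have "seq_scale D g = (\<Sum>i\<le>d. seq_scale (coeff R i) (mon i)) -
        (\<Sum>j<D. seq_scale (poly R (int j) mod D) (ind j))"
    proof
      fix n
      have "seq_scale D g n = poly R (int n) - poly R (int n) mod D"
        unfolding seq_scale_def g_eq f_def floor_eq poly_R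
        by (simp add: minus_mod_eq_mult_div)
      also have "\<dots> = (\<Sum>i\<le>d. coeff R i * mon i n) - (\<Sum>j<D. (poly R (int j) mod D) * ind j n)"
        using mod_R[of n] R_sum[of "int n"] by (simp only: mon_def)
      finally show "seq_scale D g n = ((\<Sum>i\<le>d. seq_scale (coeff R i) (mon i)) -
        (\<Sum>j<D. seq_scale (poly R (int j) mod D) (ind j))) n"
        by (simp add: seq_scale_def sum_fun_apply)
    qed
    moreover have "mon i \<in> B" if "i \<le> d" for i
      using that by (simp add: B_def)
    moreover have "ind j \<in> B" if "j < D" for j
      using that by (simp add: B_def)
    ultimately show ?thesis
      by (auto intro!: seq.span_diff seq.span_sum seq.span_scale intro: seq.span_base)
  qed
  have "\<exists>T. finite T \<and> seq.span (kernel_of_seq 2 f) = seq.span T"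
  proof (rule subspace_finitely_generated[of B "int D"])
    show "seq_scale D h \<in> seq.span B" if "h \<in> seq.span (kernel_of_seq 2 f)" for h
      using that
    proof (induction rule: seq.span_induct_alt)
      case base
      show ?case
        by (simp only: seq.scale_zero_right seq.span_zero)
    next
      case (step c x y)
      have "seq_scale D (seq_scale c x + y) = seq_scale c (seq_scale D x) + seq_scale D y"
        by (simp add: seq_scale_def fun_eq_iff algebra_simps)
      then show ?case
        using kernel[OF step(1)] step(2) by (simp only: seq.span_add seq.span_scale)
    qed
  qed (use \<open>D > 0\<close> in \<open>auto simp: B_def\<close>)
  then show ?thesis
    unfolding regular_seq_def f_def[symmetric] k_regular_iff_span by auto
qed

section \<open>Necessity: excluding an irrational non-constant coefficient\<close>

lemma regular_floor_poly_rational: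
  fixes p :: "real poly"
  assumes "regular_seq (\<lambda>n. \<lfloor>poly p (real n)\<rfloor>)"
  shows "\<forall>i\<ge>1. coeff p i \<in> \<rat>"
proof (rule ccontr)
  assume "\<not> ?thesis"
  then obtain i0 where i0: "i0 \<ge> 1" "coeff p i0 \<notin> \<rat>"
    by blast
  define A where "A = {i. i \<ge> 1 \<and> coeff p i \<notin> \<rat>}"
  have "A \<subseteq> {..degree p}"
    by (auto simp: A_def intro: le_degree)
  then have "finite A"
    by (rule finite_subset) simp
  \<comment> \<open>All indices in \<open>A\<close> are positive, so \<open>Suc e\<close> is the
    highest degree with an irrational coefficient and \<open>e\<close> fits the index
    \<open>d\<close> of \<open>poly_far_from_Ints\<close>.\<close>
  define e where "e = Max A - 1"
  have "Max A \<in> A"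
    using \<open>finite A\<close> i0 by (intro Max_in) (auto simp: A_def)
  then have Suc_e: "Suc e = Max A" and irr: "coeff p (Suc e) \<notin> \<rat>"
    by (auto simp: e_def A_def)
  have rat: "coeff p i \<in> \<rat>" if "i > Suc e" for i
    using that Max_ge[OF \<open>finite A\<close>, of i] Suc_e by (auto simp: A_def)
  obtain N :: nat where "N > 0" and
    N: "\<And>i. i \<in> {Suc e<..degree p} \<Longrightarrow> of_nat N * coeff p i \<in> \<int>"
    using common_denominator[of "{Suc e<..degree p}" "coeff p"] rat by auto
  \<comment> \<open>Chosen so that 1 / m is the distance guaranteed by
    \<open>poly_far_from_Ints\<close> in degree \<open>Suc e\<close>.\<close>
  define m :: nat where "m = 2 ^ (e + 3)"
  \<comment> \<open>In a term of positive degree a single factor \<open>M\<close> supplies both the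
    \<open>m\<close> that cancels the division in \<open>c\<close> and the \<open>N\<close> that
    clears the denominators above degree \<open>Suc e\<close>.\<close>
  define M where "M = m * N"
  have "m > 0" "M > 0"
    using \<open>N > 0\<close> by (simp_all add: m_def M_def)
  obtain k where "k \<ge> 2" "k_regular k (\<lambda>n. \<lfloor>poly p (real n)\<rfloor>)"
    using assms by (auto simp: regular_seq_def)
  then obtain a b where "a \<noteq> b" and
    cong: "\<And>n. [\<lfloor>poly p (real (k ^ a * n))\<rfloor> = \<lfloor>poly p (real (k ^ b * n))\<rfloor>] (mod int m)"
    using k_regular_dilations_cong[of k _ "int m"] \<open>m > 0\<close> by (metis of_nat_0_less_iff)
  \<comment> \<open>The coefficients of (p(k^a M x) - p(k^b M x)) / m; \<open>q\<close> keeps those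
    of degree at most \<open>Suc e\<close>.\<close>
  define c where "c = (\<lambda>i. coeff p i * (real (k ^ a * M) ^ i - real (k ^ b * M) ^ i) / m)"
  define q where "q = (\<Sum>i\<le>Suc e. monom (c i) i)"
  have poly_q: "poly q x = (\<Sum>i\<le>Suc e. c i * x ^ i)" for x
    by (simp add: q_def poly_sum poly_monom)
  have deg: "degree q \<le> Suc e"
    unfolding q_def by (intro degree_sum_le) (auto intro: order_trans[OF degree_monom_le])
  have coeff_q: "coeff q (Suc e) = c (Suc e)"
    by (simp add: q_def coeff_sum)
  have "coeff q (Suc e) \<notin> \<rat>"
  proof
    \<comment> \<open>The top coefficient of \<open>q\<close> is that of \<open>p\<close> times the
      nonzero rational \<open>t\<close>, so dividing by \<open>t\<close> would make the latter
      rational.\<close>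
    define t where "t = (real (k ^ a * M) ^ Suc e - real (k ^ b * M) ^ Suc e) / m"
    assume "coeff q (Suc e) \<in> \<rat>"
    moreover have "coeff q (Suc e) = coeff p (Suc e) * t"
      by (simp add: coeff_q c_def t_def)
    moreover have "t \<in> \<rat>"
      unfolding t_def by (intro Rats_divide Rats_diff Rats_power) auto
    moreover have "t \<noteq> 0"
    proof -
      have "k ^ a \<noteq> k ^ b"
        using \<open>a \<noteq> b\<close> \<open>k \<ge> 2\<close> by (simp add: power_inject_exp)
      then have "real (k ^ a * M) \<noteq> real (k ^ b * M)"
        using \<open>M > 0\<close> by (metis mult_right_cancel of_nat_eq_iff less_not_refl)
      then have "real (k ^ a * M) ^ Suc e \<noteq> real (k ^ b * M) ^ Suc e"
        by (metis power_inject_base of_nat_0_le_iff)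
      then show ?thesis
        using \<open>m > 0\<close> by (simp add: t_def)
    qed
    ultimately have "coeff p (Suc e) \<in> \<rat>"
      by (metis Rats_divide nonzero_mult_div_cancel_right)
    with irr show False ..
  qed
  from poly_far_from_Ints[OF deg this] obtain n :: nat where
    far: "\<And>z::int. \<bar>poly q n - z\<bar> > 1 / m"
    by (auto simp: m_def)
  have "c i * real n ^ i \<in> \<int>" if i: "i \<in> {Suc e<..degree p}" for i
  proof -
    obtain i' where i': "i = Suc i'"
      using i by (cases i) auto
    have "c i = (real N * coeff p i) * (real M ^ i' * ((real k ^ a) ^ i - (real k ^ b) ^ i))"
      (is "_ = ?r")
      using \<open>m > 0\<close> by (simp add: c_def i' M_def power_mult_distrib field_simps)
    moreover have "?r \<in> \<int>"
      by (intro Ints_mult[OF N[OF i]] Ints_mult Ints_diff Ints_power) auto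
    ultimately show ?thesis
      by (auto intro!: Ints_mult)
  qed
  then have "(\<Sum>i\<in>{Suc e<..degree p}. c i * real n ^ i) \<in> \<int>"
    by (intro Ints_sum)
  then obtain w :: int where w: "(\<Sum>i\<in>{Suc e<..degree p}. c i * real n ^ i) = w"
    by (auto elim: Ints_cases)
  have "Suc e \<le> degree p"
    using irr by (intro le_degree) auto
  \<comment> \<open>The terms above degree \<open>Suc e\<close> add up to the integer
    \<open>w\<close>, which does not change the distance to the integers.\<close>
  then have "(\<Sum>i\<le>degree p. c i * real n ^ i) = poly q n + w"
    unfolding w[symmetric] poly_q
    by (subst sum.union_disjoint[symmetric]) (auto intro!: sum.cong)
  moreover have "real m * (\<Sum>i\<le>degree p. c i * real n ^ i) =
      poly p (k ^ a * (M * n)) - poly p (k ^ b * (M * n))"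
    unfolding poly_altdef sum_subtractf[symmetric] sum_distrib_left c_def
    using \<open>m > 0\<close> by (intro sum.cong) (simp_all add: field_simps power_mult_distrib)
  ultimately have diff: "poly p (k ^ a * (M * n)) - poly p (k ^ b * (M * n)) = m * (poly q n + w)"
    by simp
  obtain z where z: "\<lfloor>poly p (real (k ^ a * (M * n)))\<rfloor> - \<lfloor>poly p (real (k ^ b * (M * n)))\<rfloor> = int m * z"
    using cong[of "M * n"] by (auto simp: cong_iff_dvd_diff elim: dvdE)
  \<comment> \<open>The left side is a difference of two fractional parts in [0, 1), so the bound is
    1 and not 2, and it is strict.\<close>
  have "\<bar>m * (poly q n + w) - m * z\<bar> < 1"
    unfolding diff[symmetric] using z by linarith
  then have "\<bar>poly q n - (z - w)\<bar> < 1 / m"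
    using \<open>m > 0\<close> by (simp add: abs_if field_simps split: if_splits)
  with far[of "z - w"] show False
    by simp
qed

theorem theorem1:
  fixes p :: "real poly"
  shows "regular_seq (\<lambda>n. \<lfloor>poly p (real n)\<rfloor>) \<longleftrightarrow> (\<forall>i\<ge>1. coeff p i \<in> \<rat>)"
  using regular_floor_poly regular_floor_poly_rational by blast

end
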